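(* Let $n\ge2$ and $m\ge0$ be integers and $c\in\mathbb{R}\setminus\{0\}$. Let $f:\mathbb{C}\to\mathbb{C}$ be a solution of $$f^{(n-1)}(x)+c\,x\,f(x)=0,\qquad x\in\mathbb{C}.$$ Then the $m$-th derivative $y=f^{(m)}$ satisfies the non-homogeneous differential equation $$y^{(n-1)}(x)+c\,x\,y(x)=-m\,c\,f^{(m-1)}(x),\qquad x\in\mathbb{C}.$$
   Context: $f^{(j)}$ denotes the $j$-th derivative; for $m=0$ the right-hand side is read as $0$. *)

theory Defs
  imports "HOL-Complex_Analysis.Complex_Analysis"
begin

(* The constant deriv is total, with an unspecified value where the derivative does not exist.
   Hence being a solution on the complex plane explicitly includes that all derivatives up to
   order n - 1 exist as complex derivatives. *)
definition solves_ode ::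
  "nat \<Rightarrow> real \<Rightarrow> (complex \<Rightarrow> complex) \<Rightarrow> (complex \<Rightarrow> complex) \<Rightarrow> bool" where
  "solves_ode n c g y \<longleftrightarrow>
     (\<forall>j < n - 1. \<forall>x. (deriv ^^ j) y field_differentiable at x) \<and>
     (\<forall>x. (deriv ^^ (n - 1)) y x + of_real c * x * y x = g x)"

end

theory Submission
  imports Defs
begin

text \<open>Write the equation as \<open>f^(k) = a x f\<close> with \<open>k = n - 1\<close>,
  \<open>a = -c\<close>, and differentiate \<open>m\<close> times. Since \<open>x\<close> has
  derivative 1 and no higher ones, only two Leibniz terms survive: \<open>a x f^(m)\<close> and
  \<open>m a f^(m-1)\<close>. \<open>higher_deriv_linear_ode\<close> proves this by induction on
  \<open>m\<close>; \<open>solves_ode_imp_entire\<close> ensures that all the derivatives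
  exist.\<close>

lemma has_field_derivative_higher_deriv_entire:
  assumes "f holomorphic_on UNIV"
  shows "((deriv ^^ k) f has_field_derivative (deriv ^^ Suc k) f x) (at x)"
proof -
  have "(deriv ^^ k) f holomorphic_on UNIV"
    using assms by (intro holomorphic_higher_deriv) auto
  then show ?thesis
    by (simp add: holomorphic_derivI[of _ UNIV])
qed

text \<open>For \<open>n \<ge> 2\<close> the index \<open>j = 0\<close> falls under the
  differentiability clause, and one complex derivative everywhere already gives all orders.\<close>

lemma solves_ode_imp_entire:
  assumes "n \<ge> 2" and "solves_ode n c g f"
  shows "f holomorphic_on UNIV"
proof -
  have "0 < n - 1"
    using assms(1) by simp
  then have "(deriv ^^ 0) f field_differentiable at x" for x
    using assms(2) unfolding solves_ode_def by blast
  then show ?thesis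
    by (simp add: holomorphic_on_def field_differentiable_at_within)
qed

lemma higher_deriv_linear_ode:
  fixes f :: "complex \<Rightarrow> complex"
  assumes hol: "f holomorphic_on UNIV"
    and ode: "\<And>x. (deriv ^^ k) f x = a * x * f x"
  shows "(deriv ^^ (k + m)) f x =
    a * x * (deriv ^^ m) f x + of_nat m * a * (deriv ^^ (m - 1)) f x"
proof (induction m arbitrary: x)
  case 0
  show ?case by (simp add: ode)
next
  case (Suc m)
  note D = has_field_derivative_higher_deriv_entire[OF hol]
  let ?R = "\<lambda>x. a * x * (deriv ^^ m) f x + of_nat m * a * (deriv ^^ (m - 1)) f x"
  \<comment> \<open>The induction hypothesis holds at every point, so it is an identity of functions
    and can be differentiated.\<close>
  have "(deriv ^^ (k + m)) f = ?R"
    using Suc.IH by (rule ext)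
  then have "(deriv ^^ (k + Suc m)) f x = deriv ?R x"
    by simp
  also have "\<dots> = a * (deriv ^^ m) f x + a * x * (deriv ^^ Suc m) f x
      + of_nat m * a * (deriv ^^ Suc (m - 1)) f x"
    by (rule DERIV_imp_deriv) (auto intro!: derivative_eq_intros D simp del: funpow.simps)
  \<comment> \<open>For \<open>m = 0\<close>, \<open>Suc (m - 1)\<close> is 1, not \<open>m\<close>,
    but the factor \<open>of_nat m\<close> makes both sides zero.\<close>
  also have "of_nat m * a * (deriv ^^ Suc (m - 1)) f x = of_nat m * a * (deriv ^^ m) f x"
    by (cases m) simp_all
  finally show ?case
    by (simp add: algebra_simps)
qed

theorem mainTheorem5:
  fixes n m :: nat and c :: real and f :: "complex \<Rightarrow> complex"
  assumes "n \<ge> 2" and "c \<noteq> 0"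
    and "solves_ode n c (\<lambda>x. 0) f"
  shows "solves_ode n c
           (\<lambda>x. if m = 0 then 0 else - of_nat m * of_real c * (deriv ^^ (m - 1)) f x)
           ((deriv ^^ m) f)"
proof -
  have hol: "f holomorphic_on UNIV"
    using assms(1,3) by (rule solves_ode_imp_entire)
  have comp: "(deriv ^^ j) ((deriv ^^ m) f) = (deriv ^^ (j + m)) f" for j
    by (simp add: funpow_add)
  have "(deriv ^^ (n - 1)) f x = - of_real c * x * f x" for x
    using assms(3) by (simp add: solves_ode_def add_eq_0_iff2)
  note eq = higher_deriv_linear_ode[OF hol this, of m]
  have "(deriv ^^ j) ((deriv ^^ m) f) field_differentiable at x" for j x
    unfolding comp field_differentiable_def
    using has_field_derivative_higher_deriv_entire[OF hol] by blast
  moreover have "(deriv ^^ (n - 1)) ((deriv ^^ m) f) x + of_real c * x * (deriv ^^ m) f x =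
      (if m = 0 then 0 else - of_nat m * of_real c * (deriv ^^ (m - 1)) f x)" for x
    \<comment> \<open>Here \<open>a = - of_real c\<close>, so the \<open>x\<close> terms cancel; for
      \<open>m = 0\<close> the factor \<open>of_nat m\<close> kills the rest.\<close>
    unfolding comp eq by simp
  ultimately show ?thesis
    unfolding solves_ode_def by blast
qed

end
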